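(* Let $\phi$ be a real entire function that is the limit, uniformly on compact subsets of $\mathbb{C}$, of real polynomials all of whose zeros are real and negative. Then the sequence $\{\phi(i)\}_{i=0}^\infty$ is a discrete multiplier sequence.
   Context: A polynomial in $\mathbb{R}[x]$ is called hyperbolic if all its zeros are real. For a hyperbolic $p$, $\operatorname{mesh}(p)$ is the minimal distance between its roots; if $p$ has a multiple root, then $\operatorname{mesh}(p):=0$; polynomials of degree at most $1$ are defined to have mesh $+\infty$. $\mathcal{HP}^{+}_{\ge 1}$ denotes the set of hyperbolic polynomials with mesh at least $1$ and with only non-negative zeros; by convention the zero polynomial and the nonzero constants belong to it. The Pochhammer polynomials are $(x)_0=1$, $(x)_i=x(x-1)\cdots(x-i+1)$ for $i\ge 1$. A real sequence $\{\alpha_i\}_{i=0}^\infty$ is called a discrete multiplier sequence if the linear operator $T:\mathbb{R}[x]\to\mathbb{R}[x]$ determined by $T((x)_i)=\alpha_i (x)_i$ for all $i\ge 0$ satisfies $T(\mathcal{HP}^{+}_{\ge 1})\subseteq\mathcal{HP}^{+}_{\ge 1}$. *)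

theory Defs
  imports
    "HOL-Complex_Analysis.Complex_Analysis"
    "HOL-Computational_Algebra.Polynomial"
begin

abbreviation cpoly :: "real poly \<Rightarrow> complex \<Rightarrow> complex" where
  "cpoly p \<equiv> poly (map_poly complex_of_real p)"

text \<open>With this definition the zero polynomial is not hyperbolic; it is added
  separately in \<open>HP_plus_ge_1\<close>.\<close>

definition hyperbolic :: "real poly \<Rightarrow> bool" where
  "hyperbolic p \<longleftrightarrow> (\<forall>z. cpoly p z = 0 \<longrightarrow> z \<in> \<real>)"

text \<open>Only real roots are considered, so this is meaningful for hyperbolic polynomials only.
  For these, in the last case, the infimum is a minimum over a finite nonempty set.\<close>

definition mesh :: "real poly \<Rightarrow> ereal" where
  "mesh p =
    (if degree p \<le> 1 then \<infinity>
     else if \<exists>x. order x p \<ge> 2 then 0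
     else Inf {ereal \<bar>x - y\<bar> | x y. poly p x = 0 \<and> poly p y = 0 \<and> x \<noteq> y})"

definition HP_plus_ge_1 :: "real poly set" where
  "HP_plus_ge_1 =
    insert 0 {p. hyperbolic p \<and> mesh p \<ge> 1 \<and> (\<forall>x. poly p x = 0 \<longrightarrow> x \<ge> 0)}"

text \<open>The falling factorial \<open>x (x - 1) \<dots> (x - i + 1)\<close>, in contrast to the
  library constant \<open>pochhammer\<close>, which is the rising one.\<close>

definition pochhammer_poly :: "nat \<Rightarrow> real poly" where
  "pochhammer_poly i = (\<Prod>k<i. [:- real k, 1:])"

text \<open>The polynomials \<open>pochhammer_poly i\<close> form a basis of the real polynomials, so the operator
  \<open>T\<close> below exists and is unique.\<close>

definition discrete_multiplier_sequence :: "(nat \<Rightarrow> real) \<Rightarrow> bool" where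
  "discrete_multiplier_sequence \<alpha> \<longleftrightarrow>
    (\<exists>T. Vector_Spaces.linear smult smult T \<and>
         (\<forall>i. T (pochhammer_poly i) = smult (\<alpha> i) (pochhammer_poly i)) \<and>
         T ` HP_plus_ge_1 \<subseteq> HP_plus_ge_1)"

end

theory Submission
  imports Defs
begin

text \<open>
  For a linear multiplier \<open>\<alpha> i = i + a\<close> with \<open>a > 0\<close> the diagonal operator is a first order
  difference operator: since \<open>x ((x)\<^sub>i - (x - 1)\<^sub>i) = i (x)\<^sub>i\<close>, it maps \<open>p\<close> to
  \<open>q(x) = (x + a) p(x) - x p(x - 1)\<close>. Let \<open>p\<close> have the zeros \<open>0 \<le> x\<^sub>0 < \<dots> < x\<^bsub>n-1\<^esub>\<close> with gaps
  at least 1. The signs of \<open>p\<close> show that \<open>q\<close> has a zero \<open>y\<^sub>0\<close> in \<open>[0, x\<^sub>0]\<close> and a zero \<open>y\<^sub>j\<close> in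
  \<open>[x\<^bsub>j-1\<^esub> + 1, x\<^sub>j]\<close> for every \<open>j \<ge> 1\<close>. As \<open>q\<close> has degree at most \<open>n\<close>, these are all its zeros,
  and they are again non-negative with gaps at least 1: \<open>y\<^bsub>j+1\<^esub> \<ge> x\<^sub>j + 1 \<ge> y\<^sub>j + 1\<close>. Moreover
  \<open>y\<^sub>j \<le> x\<^sub>j\<close>, so every upper bound for the zeros of \<open>p\<close> is one for the zeros of \<open>q\<close>
  (\<open>backward_shift_interlaces\<close>).

  Composing such operators gives the multipliers \<open>\<alpha> i = P(i)\<close> for polynomials \<open>P\<close> with negative
  zeros. The bound on the zeros survives the composition, and this makes the passage to the limit
  \<open>P\<^sub>m \<longrightarrow> \<phi>\<close> a compactness argument: for fixed \<open>p\<close> of degree \<open>n\<close> with zeros in \<open>[0, B]\<close>, the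
  images of \<open>p\<close> are multiples of monic polynomials of degree \<open>n\<close> with spaced zeros in \<open>[0, B]\<close>,
  a compact family, so no zero escapes to infinity and the limit is a multiple of another member
  of this family (\<open>spaced_polys_closed\<close>). The multiple may be zero, which covers the case of
  vanishing values of \<open>\<phi>\<close>.
\<close>

section \<open>Polynomials with spaced zeros\<close>

lemma poly_ext: "(\<And>t. poly p t = poly q t) \<Longrightarrow> p = (q :: real poly)"
  by (simp add: poly_eq_poly_eq_iff[symmetric] fun_eq_iff)

definition root_poly :: "nat \<Rightarrow> (nat \<Rightarrow> real) \<Rightarrow> real poly" where
  "root_poly n x = (\<Prod>j<n. [:- x j, 1:])"

definition spaced :: "nat \<Rightarrow> real \<Rightarrow> (nat \<Rightarrow> real) \<Rightarrow> bool" where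
  "spaced n B x \<longleftrightarrow> (\<forall>j<n. 0 \<le> x j \<and> x j \<le> B) \<and> (\<forall>j<n. \<forall>i<j. x i + 1 \<le> x j)"

text \<open>The factor \<open>c\<close> may be 0. Hence the set contains the zero polynomial and, for fixed \<open>n\<close> and
  \<open>B\<close>, is closed under limits.\<close>

definition spaced_polys :: "nat \<Rightarrow> real \<Rightarrow> real poly set" where
  "spaced_polys n B = {smult c (root_poly n x) | c x. spaced n B x}"

lemma spaced_inj_on: "spaced n B x \<Longrightarrow> inj_on x {..<n}"
  by (intro linorder_inj_onI) (force simp: spaced_def)+

lemma root_poly_nonzero [simp]: "root_poly n x \<noteq> 0"
  by (simp add: root_poly_def)

lemma degree_root_poly [simp]: "degree (root_poly n x) = n"
  by (simp add: root_poly_def degree_prod_sum_eq)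

lemma coeff_root_poly_degree [simp]: "coeff (root_poly n x) n = 1"
  using lead_coeff_prod[of "\<lambda>j. [:- x j, 1:]" "{..<n}"]
  by (simp add: root_poly_def degree_prod_sum_eq)

lemma poly_root_poly: "poly (root_poly n x) t = (\<Prod>j<n. t - x j)"
  by (simp add: root_poly_def poly_prod)

lemma poly_root_poly_eq_0_iff: "poly (root_poly n x) t = 0 \<longleftrightarrow> (\<exists>j<n. t = x j)"
  by (auto simp: poly_root_poly)

text \<open>The factor is \<open>coeff q n\<close> rather than the leading coefficient of \<open>q\<close>, so that \<open>q = 0\<close> is
  included and the degree of \<open>q\<close> has to be estimated only from above.\<close>

lemma eq_smult_root_poly:
  assumes "degree q \<le> n" "inj_on y {..<n}" "\<And>j. j < n \<Longrightarrow> poly q (y j) = 0"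
  shows "q = smult (coeff q n) (root_poly n y)"
proof (rule poly_eqI_degree_lead_coeff[where A = "y ` {..<n}" and n = n])
  show "card (y ` {..<n}) \<ge> n"
    using assms(2) by (simp add: card_image)
  show "degree (smult (coeff q n) (root_poly n y)) \<le> n"
    by (metis degree_root_poly degree_smult_le)
  fix z assume "z \<in> y ` {..<n}"
  then obtain j where "j < n" "z = y j" by auto
  then show "poly q z = poly (smult (coeff q n) (root_poly n y)) z"
    using assms(3) poly_root_poly_eq_0_iff by auto
qed (use assms(1) in auto)

section \<open>Adding a zero to the multiplier\<close>

text \<open>The point \<open>t\<close> lies between the first \<open>k\<close> zeros and the other \<open>n - k\<close>, each of which
  contributes one non-positive factor. The inequalities are weak because consecutive zeros may be at
  distance exactly 1, in which case the intervals of the next lemma shrink to a point.\<close>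

lemma sign_root_poly:
  assumes "\<And>j. j < k \<Longrightarrow> x j \<le> t" "\<And>j. k \<le> j \<Longrightarrow> j < n \<Longrightarrow> t \<le> x j" "k \<le> n"
  shows "0 \<le> (-1) ^ (n - k) * poly (root_poly n x) t"
proof -
  have split: "{..<n} = {..<k} \<union> {k..<n}" using assms(3) by auto
  have "(\<Prod>j<n. t - x j) = (\<Prod>j<k. t - x j) * (\<Prod>j=k..<n. t - x j)"
    unfolding split by (rule prod.union_disjoint) auto
  also have "(\<Prod>j=k..<n. t - x j) = (\<Prod>j=k..<n. (-1) * (x j - t))"
    by simp
  also have "\<dots> = (-1) ^ (n - k) * (\<Prod>j=k..<n. x j - t)"
    by (subst prod.distrib) simp
  finally have "(-1) ^ (n - k) * poly (root_poly n x) t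
      = (\<Prod>j<k. t - x j) * (\<Prod>j=k..<n. x j - t)"
    by (simp add: poly_root_poly)
  also have "\<dots> \<ge> 0"
    using assms by (intro mult_nonneg_nonneg prod_nonneg) auto
  finally show ?thesis .
qed

text \<open>In the interval from \<open>x (j - 1) + 1\<close> to \<open>x j\<close> the values of \<open>q\<close> at the ends have weakly
  opposite signs: at the left end the second term of \<open>q\<close> vanishes, at the right end the first one
  does, and both \<open>x (j - 1) + 1\<close> and \<open>x j - 1\<close> lie between \<open>x (j - 1)\<close> and \<open>x j\<close>, where the sign
  of the polynomial is known. For \<open>j = 0\<close> the left end is 0, where the second term vanishes because
  of its factor \<open>t\<close>.\<close>

lemma backward_shift_interlaces:
  assumes x: "spaced n B x" and a: "a > 0"
    and q: "\<And>t. poly q t = (t + a) * poly (root_poly n x) t - t * poly (root_poly n x) (t - 1)"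
  shows "q \<in> spaced_polys n B"
proof -
  let ?p = "root_poly n x"
  define l where "l j = (if j = 0 then 0 else x (j - 1) + 1)" for j
  have x0: "0 \<le> x j" "x j \<le> B" if "j < n" for j
    using x that by (auto simp: spaced_def)
  have gap: "x i + 1 \<le> x j" if "i < j" "j < n" for i j
    using x that by (auto simp: spaced_def)
  have mono: "x i \<le> x j" if "i \<le> j" "j < n" for i j
    using gap[of i j] that by (cases "i = j") auto
  have l_le: "l j \<le> x j" if "j < n" for j
    using that x0 gap by (auto simp: l_def)
  have l_nonneg: "0 \<le> l j" if "j < n" for j
    using that x0[of "j - 1"] by (auto simp: l_def)
  have x_le_l: "x i + 1 \<le> l j" if "i < j" "j < n" for i j
    using that mono[of i "j - 1"] by (auto simp: l_def)
  have root: "\<exists>y. l j \<le> y \<and> y \<le> x j \<and> poly q y = 0" if j: "j < n" for j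
  proof -
    define s where "s = (-1 :: real) ^ (n - j)"
    have p_left: "0 \<le> s * poly ?p (l j)"
      unfolding s_def
    proof (rule sign_root_poly)
      fix i assume "i < j"
      then show "x i \<le> l j" using x_le_l[of i j] j by simp
    next
      fix i assume "j \<le> i" "i < n"
      then show "l j \<le> x i" using l_le[OF j] mono[of j i] by simp
    qed (use j in simp)
    have zero: "l j * poly ?p (l j - 1) = 0"
    proof (cases "j = 0")
      case False
      then have "j - 1 < n" "l j - 1 = x (j - 1)" using j by (auto simp: l_def)
      then have "poly ?p (l j - 1) = 0" using poly_root_poly_eq_0_iff by blast
      then show ?thesis by simp
    qed (simp add: l_def)
    have "s * poly q (l j) = (l j + a) * (s * poly ?p (l j)) - s * (l j * poly ?p (l j - 1))"
      by (simp add: q algebra_simps)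
    also have "\<dots> = (l j + a) * (s * poly ?p (l j))"
      by (simp only: zero)
    also have "\<dots> \<ge> 0"
      using l_nonneg[OF j] a by (intro mult_nonneg_nonneg[OF _ p_left]) simp
    finally have left: "0 \<le> s * poly q (l j)" .
    have p_right: "0 \<le> s * poly ?p (x j - 1)"
      unfolding s_def
    proof (rule sign_root_poly)
      fix i assume "i < j"
      then show "x i \<le> x j - 1" using gap[of i j] j by simp
    next
      fix i assume "j \<le> i" "i < n"
      then show "x j - 1 \<le> x i" using mono[of j i] by simp
    qed (use j in simp)
    have "poly ?p (x j) = 0"
      using j poly_root_poly_eq_0_iff by blast
    then have "s * poly q (x j) = - (x j * (s * poly ?p (x j - 1)))"
      by (simp add: q)
    also have "\<dots> \<le> 0"
      using mult_nonneg_nonneg[OF x0(1)[OF j] p_right] by simp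
    finally have right: "s * poly q (x j) \<le> 0" .
    have "\<exists>y\<ge>l j. y \<le> x j \<and> s * poly q y = 0"
      by (rule IVT2'[OF right left l_le[OF j]]) (intro continuous_intros)
    then show ?thesis by (auto simp: s_def)
  qed
  then obtain y where y: "l j \<le> y j" "y j \<le> x j" "poly q (y j) = 0" if "j < n" for j
    by metis
  have spaced_y: "spaced n B y"
    unfolding spaced_def
  proof (intro conjI allI impI)
    fix j assume j: "j < n"
    show "0 \<le> y j" using y[OF j] l_nonneg[OF j] by simp
    show "y j \<le> B" using y[OF j] x0[OF j] by simp
    fix i assume i: "i < j"
    then show "y i + 1 \<le> y j" using y(2)[of i] y(1)[OF j] x_le_l[of i j] j by simp
  qed
  define p' where "p' = root_poly n (\<lambda>j. x j + 1)"
  have "poly p' t = poly ?p (t - 1)" for t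
    by (simp add: p'_def poly_root_poly algebra_simps)
  then have q_eq: "q = [:a, 1:] * ?p - pCons 0 p'"
    by (intro poly_ext) (simp add: q algebra_simps)
  \<comment> \<open>In degree \<open>n + 1\<close> the two leading terms cancel.\<close>
  have "coeff q m = 0" if "n < m" for m
  proof (cases m)
    case (Suc k)
    then show ?thesis
    proof (cases "k = n")
      case True
      then show ?thesis using Suc by (simp add: q_eq p'_def coeff_eq_0)
    next
      case False
      then show ?thesis using Suc that by (simp add: q_eq p'_def coeff_eq_0)
    qed
  qed (use that in simp)
  then have "degree q \<le> n" by (auto intro: degree_le)
  then have "q = smult (coeff q n) (root_poly n y)"
    using spaced_inj_on[OF spaced_y] y(3) by (rule eq_smult_root_poly)
  then show ?thesis using spaced_y by (auto simp: spaced_polys_def)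
qed

definition falling_sum :: "nat \<Rightarrow> (nat \<Rightarrow> real) \<Rightarrow> real poly" where
  "falling_sum N b = (\<Sum>i<N. smult (b i) (pochhammer_poly i))"

text \<open>The action of the diagonal operator, expressed on expansions in falling factorials; the number
  \<open>n\<close> of zeros and the bound \<open>B\<close> must be the same before and after.\<close>

definition preserves_spacing :: "(nat \<Rightarrow> real) \<Rightarrow> bool" where
  "preserves_spacing \<alpha> \<longleftrightarrow> (\<forall>n B N b. falling_sum N b \<in> spaced_polys n B \<longrightarrow>
     falling_sum N (\<lambda>i. \<alpha> i * b i) \<in> spaced_polys n B)"

lemma preserves_spacingD:
  "preserves_spacing \<alpha> \<Longrightarrow> falling_sum N b \<in> spaced_polys n B \<Longrightarrow>
     falling_sum N (\<lambda>i. \<alpha> i * b i) \<in> spaced_polys n B"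
  by (simp add: preserves_spacing_def)

lemma spaced_polys_smult: "p \<in> spaced_polys n B \<Longrightarrow> smult c p \<in> spaced_polys n B"
  by (auto simp: spaced_polys_def) (metis smult_smult)

lemma poly_falling_sum: "poly (falling_sum N b) t = (\<Sum>i<N. b i * poly (pochhammer_poly i) t)"
  by (simp add: falling_sum_def poly_sum)

lemma poly_pochhammer_poly: "poly (pochhammer_poly i) t = (\<Prod>k<i. t - real k)"
  by (simp add: pochhammer_poly_def poly_prod)

text \<open>The falling factorials are the eigenvectors of \<open>p(t) \<mapsto> t (p(t) - p(t - 1))\<close>, because
  \<open>t (t - 1)\<^sub>i = (t)\<^bsub>i+1\<^esub> = (t - i) (t)\<^sub>i\<close>.\<close>

lemma pochhammer_poly_backward_shift:
  "(t + a) * poly (pochhammer_poly i) t - t * poly (pochhammer_poly i) (t - 1)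
    = (real i + a) * poly (pochhammer_poly i) t"
proof -
  have "t * (\<Prod>k<i. t - 1 - real k) = (\<Prod>k<Suc i. t - real k)"
    unfolding prod.lessThan_Suc_shift by (simp add: algebra_simps)
  also have "\<dots> = (t - real i) * (\<Prod>k<i. t - real k)"
    by simp
  finally show ?thesis by (simp add: poly_pochhammer_poly algebra_simps)
qed

lemma preserves_spacing_shift:
  assumes "a > 0"
  shows "preserves_spacing (\<lambda>i. real i + a)"
  unfolding preserves_spacing_def
proof (intro allI impI)
  fix n B N b assume "falling_sum N b \<in> spaced_polys n B"
  then obtain c x where p: "falling_sum N b = smult c (root_poly n x)" and x: "spaced n B x"
    by (auto simp: spaced_polys_def)
  define q where "q = [:a, 1:] * root_poly n x - pCons 0 (pcompose (root_poly n x) [:-1, 1:])"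
  have q: "poly q t = (t + a) * poly (root_poly n x) t - t * poly (root_poly n x) (t - 1)" for t
    by (simp add: q_def poly_pcompose algebra_simps)
  have "falling_sum N (\<lambda>i. (real i + a) * b i) = smult c q"
  proof (rule poly_ext)
    fix t
    have "poly (falling_sum N (\<lambda>i. (real i + a) * b i)) t
        = (\<Sum>i<N. b i * ((t + a) * poly (pochhammer_poly i) t - t * poly (pochhammer_poly i) (t - 1)))"
      by (simp add: poly_falling_sum pochhammer_poly_backward_shift mult_ac)
    also have "\<dots> = (t + a) * poly (falling_sum N b) t - t * poly (falling_sum N b) (t - 1)"
      by (simp add: poly_falling_sum sum_distrib_left sum_subtractf[symmetric] algebra_simps)
    also have "\<dots> = poly (smult c q) t"
      by (simp add: p q algebra_simps)
    finally show "poly (falling_sum N (\<lambda>i. (real i + a) * b i)) t = poly (smult c q) t" .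
  qed
  then show "falling_sum N (\<lambda>i. (real i + a) * b i) \<in> spaced_polys n B"
    using backward_shift_interlaces[OF x assms q] by (simp add: spaced_polys_smult)
qed

lemma preserves_spacing_const: "preserves_spacing (\<lambda>i. c)"
proof -
  have "falling_sum N (\<lambda>i. c * b i) = smult c (falling_sum N b)" for N b
    by (rule poly_ext) (simp add: poly_falling_sum sum_distrib_left mult.assoc)
  then show ?thesis by (simp add: preserves_spacing_def spaced_polys_smult)
qed

lemma preserves_spacing_mult:
  assumes "preserves_spacing \<alpha>" "preserves_spacing \<beta>"
  shows "preserves_spacing (\<lambda>i. \<alpha> i * \<beta> i)"
  using assms unfolding preserves_spacing_def by (simp add: mult.assoc)

section \<open>Evaluating real polynomials at complex points\<close>

lemma cpoly_add: "cpoly (p + q) z = cpoly p z + cpoly q z"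
  by (induction p q rule: poly_induct2) (simp_all add: map_poly_pCons algebra_simps)

lemma cpoly_mult: "cpoly (p * q) z = cpoly p z * cpoly q z"
proof (induction p)
  case (pCons a p)
  have "cpoly (smult a q) z = of_real a * cpoly q z"
    by (induction q) (simp_all add: map_poly_pCons algebra_simps)
  then show ?case using pCons by (simp add: cpoly_add map_poly_pCons algebra_simps)
qed simp

lemma cpoly_of_real: "cpoly p (of_real t) = of_real (poly p t)"
  by (induction p) (simp_all add: map_poly_pCons)

lemma cpoly_root_exists:
  assumes "degree p > 0"
  shows "\<exists>z. cpoly p z = 0"
proof -
  have "coeff (map_poly complex_of_real p) (degree p) \<noteq> 0"
    using assms by (auto simp: coeff_map_poly)
  with assms have "\<exists>i\<in>{1..degree p}. coeff (map_poly complex_of_real p) i \<noteq> 0"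
    by (intro bexI[of _ "degree p"]) auto
  then obtain z where "(\<Sum>i\<le>degree p. coeff (map_poly complex_of_real p) i * z ^ i) = 0"
    using fundamental_theorem_of_algebra by blast
  then show ?thesis by (intro exI[of _ z]) (simp add: poly_altdef degree_map_poly)
qed

text \<open>Induction on the degree: splitting off a zero \<open>r < 0\<close> leaves the factor \<open>i - r\<close>, which is
  the linear multiplier with \<open>a = - r > 0\<close>.\<close>

lemma preserves_spacing_negative_zeros:
  assumes "\<And>z. cpoly P z = 0 \<Longrightarrow> z \<in> \<real> \<and> Re z < 0"
  shows "preserves_spacing (\<lambda>i. poly P (real i))"
  using assms
proof (induction "degree P" arbitrary: P)
  case 0
  then obtain c where "P = [:c:]" by (metis degree_eq_zeroE)
  then show ?case by (simp add: preserves_spacing_const)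
next
  case (Suc d)
  from Suc(2) obtain z where "cpoly P z = 0" using cpoly_root_exists[of P] by auto
  with Suc(3) obtain r where r: "z = of_real r" "r < 0" by (metis Re_complex_of_real Reals_cases)
  with \<open>cpoly P z = 0\<close> have "poly P r = 0" by (simp add: cpoly_of_real)
  then obtain Q where Q: "P = [:- r, 1:] * Q" by (metis dvdE poly_eq_0_iff_dvd)
  with Suc(2) have "Q \<noteq> 0" by auto
  then have "d = degree Q" using Suc(2) Q by (simp add: degree_mult_eq del: mult_pCons_left)
  moreover have "z \<in> \<real> \<and> Re z < 0" if "cpoly Q z = 0" for z
    using that by (intro Suc(3)) (simp add: Q cpoly_mult del: mult_pCons_left)
  ultimately have "preserves_spacing (\<lambda>i. poly Q (real i))" by (rule Suc(1))
  with preserves_spacing_shift[of "- r"] r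
  have "preserves_spacing (\<lambda>i. (real i + - r) * poly Q (real i))"
    by (intro preserves_spacing_mult) auto
  then show ?case by (simp add: Q algebra_simps)
qed

section \<open>Limits of multipliers\<close>

text \<open>Bolzano-Weierstrass in the cube \<open>[0, B]\<^sup>n\<close>; spacing is a closed condition.\<close>

lemma spaced_subsequence:
  fixes x :: "nat \<Rightarrow> nat \<Rightarrow> real"
  assumes "\<And>m. spaced n B (x m)"
  shows "\<exists>y r. strict_mono r \<and> spaced n B y \<and> (\<forall>j<n. (\<lambda>m. x (r m) j) \<longlonglongrightarrow> y j)"
proof -
  have "bounded ((\<lambda>y. y j) ` range x)" if "j \<in> {..<n}" for j
  proof (rule bounded_subset)
    show "(\<lambda>y. y j) ` range x \<subseteq> {0..B}"
      using assms that by (auto simp: spaced_def)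
  qed auto
  then obtain y r where r: "strict_mono r"
    and ev: "\<forall>e>0. \<forall>\<^sub>F m in sequentially. \<forall>j\<in>{..<n}. dist (x (r m) j) (y j) < e"
    using compact_lemma_general[of "{..<n}" "\<lambda>y j. y j" x "\<lambda>e. e"] by auto
  have lim: "(\<lambda>m. x (r m) j) \<longlonglongrightarrow> y j" if "j < n" for j
    unfolding tendsto_iff using ev that by (auto elim!: eventually_mono)
  have "spaced n B y"
    unfolding spaced_def
  proof (intro conjI allI impI)
    fix j assume j: "j < n"
    show "0 \<le> y j" "y j \<le> B"
      using assms j by (auto intro: LIMSEQ_le_const[OF lim[OF j]] LIMSEQ_le_const2[OF lim[OF j]]
        simp: spaced_def)
    fix i assume "i < j"
    then show "y i + 1 \<le> y j"
      using assms j by (intro LIMSEQ_le[OF tendsto_add[OF lim tendsto_const] lim])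
        (auto simp: spaced_def)
  qed
  with r lim show ?thesis by blast
qed

text \<open>Every member is its coefficient of degree \<open>n\<close> times the monic polynomial of its zeros. The
  coefficients converge by hypothesis, the zeros along a subsequence by compactness, and the limit
  has to be the product of the two limits. If the coefficients tend to 0, the limit is 0: the
  degree of a nonzero limit is again \<open>n\<close>.\<close>

lemma spaced_polys_closed:
  assumes p: "\<And>m. p m \<in> spaced_polys n B"
    and lim: "\<And>t. (\<lambda>m. poly (p m) t) \<longlonglongrightarrow> poly q t"
    and c: "(\<lambda>m. coeff (p m) n) \<longlonglongrightarrow> c"
  shows "q \<in> spaced_polys n B"
proof -
  have "\<exists>x. spaced n B x \<and> p m = smult (coeff (p m) n) (root_poly n x)" for m
    using p[of m] by (auto simp: spaced_polys_def)
  then obtain x where x: "\<And>m. spaced n B (x m)"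
    and px: "\<And>m. p m = smult (coeff (p m) n) (root_poly n (x m))"
    by metis
  from spaced_subsequence[of n B x, OF x] obtain y r where r: "strict_mono r"
    and y: "spaced n B y" and xy: "\<And>j. j < n \<Longrightarrow> (\<lambda>m. x (r m) j) \<longlonglongrightarrow> y j"
    by blast
  have "q = smult c (root_poly n y)"
  proof (rule poly_ext)
    fix t
    have "(\<lambda>m. coeff (p (r m)) n * (\<Prod>j<n. t - x (r m) j)) \<longlonglongrightarrow> c * (\<Prod>j<n. t - y j)"
      using LIMSEQ_subseq_LIMSEQ[OF c r] xy by (intro tendsto_intros) (auto simp: o_def)
    also have "(\<lambda>m. coeff (p (r m)) n * (\<Prod>j<n. t - x (r m) j)) = (\<lambda>m. poly (p (r m)) t)"
      by (subst (2) px) (simp add: poly_root_poly)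
    finally have "(\<lambda>m. poly (p (r m)) t) \<longlonglongrightarrow> poly (smult c (root_poly n y)) t"
      by (simp add: poly_root_poly)
    moreover have "(\<lambda>m. poly (p (r m)) t) \<longlonglongrightarrow> poly q t"
      using LIMSEQ_subseq_LIMSEQ[OF lim r] by (simp add: o_def)
    ultimately show "poly q t = poly (smult c (root_poly n y)) t"
      by (rule LIMSEQ_unique[rotated])
  qed
  with y show ?thesis by (auto simp: spaced_polys_def)
qed

lemma preserves_spacing_limit:
  assumes "\<And>m. preserves_spacing (\<alpha> m)" "\<And>i. (\<lambda>m. \<alpha> m i) \<longlonglongrightarrow> \<beta> i"
  shows "preserves_spacing \<beta>"
  unfolding preserves_spacing_def
proof (intro allI impI)
  fix n B N b assume *: "falling_sum N b \<in> spaced_polys n B"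
  show "falling_sum N (\<lambda>i. \<beta> i * b i) \<in> spaced_polys n B"
  proof (rule spaced_polys_closed)
    show "falling_sum N (\<lambda>i. \<alpha> m i * b i) \<in> spaced_polys n B" for m
      using assms(1) * by (rule preserves_spacingD)
    show "(\<lambda>m. poly (falling_sum N (\<lambda>i. \<alpha> m i * b i)) t)
        \<longlonglongrightarrow> poly (falling_sum N (\<lambda>i. \<beta> i * b i)) t" for t
      unfolding poly_falling_sum by (intro tendsto_intros assms(2))
    show "(\<lambda>m. coeff (falling_sum N (\<lambda>i. \<alpha> m i * b i)) n)
        \<longlonglongrightarrow> (\<Sum>i<N. \<beta> i * b i * coeff (pochhammer_poly i) n)"
      unfolding falling_sum_def coeff_sum coeff_smult by (intro tendsto_intros assms(2))
  qed
qed

section \<open>Mesh at least one means spaced zeros\<close>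

text \<open>Real linear factors are split off one by one; the bound on the orders keeps the new zero out
  of the set of zeros of the cofactor.\<close>

lemma hyperbolic_factorization:
  assumes "hyperbolic p" "p \<noteq> 0" "\<And>x. order x p \<le> 1"
  shows "\<exists>c A. c \<noteq> 0 \<and> finite A \<and> p = smult c (\<Prod>x\<in>A. [:- x, 1:])"
  using assms
proof (induction "degree p" arbitrary: p)
  case 0
  then obtain c where "p = [:c:]" by (metis degree_eq_zeroE)
  then show ?case using 0 by (intro exI[of _ c] exI[of _ "{}"]) auto
next
  case (Suc d)
  from Suc(2) obtain z where "cpoly p z = 0" using cpoly_root_exists[of p] by auto
  with Suc(3) obtain r where "z = of_real r" unfolding hyperbolic_def by (metis Reals_cases)
  with \<open>cpoly p z = 0\<close> have "poly p r = 0" by (simp add: cpoly_of_real)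
  then obtain q where q: "p = [:- r, 1:] * q" by (metis dvdE poly_eq_0_iff_dvd)
  with Suc(4) have "q \<noteq> 0" by auto
  have ord: "order x p = order x [:- r, 1:] + order x q" for x
    unfolding q using \<open>q \<noteq> 0\<close> by (intro order_mult) (simp del: mult_pCons_left)
  have "d = degree q" using \<open>q \<noteq> 0\<close> Suc(2) q by (simp add: degree_mult_eq del: mult_pCons_left)
  moreover have "hyperbolic q"
    using Suc(3) by (simp add: hyperbolic_def q cpoly_mult del: mult_pCons_left)
  moreover have "order x q \<le> 1" for x
    using Suc(5)[of x] ord[of x] by simp
  ultimately obtain c A where A: "c \<noteq> 0" "finite A" "q = smult c (\<Prod>x\<in>A. [:- x, 1:])"
    using Suc(1) \<open>q \<noteq> 0\<close> by blast
  have "order r [:- r, 1:] > 0" by (subst order_gt_0_iff) auto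
  then have "poly q r \<noteq> 0"
    using Suc(5)[of r] ord[of r] \<open>q \<noteq> 0\<close> by (simp add: order_root)
  then have "r \<notin> A" using A by (auto simp: poly_prod)
  then have "p = smult c (\<Prod>x\<in>insert r A. [:- x, 1:])"
    using A by (simp add: q del: mult_pCons_left)
  then show ?case using A by blast
qed

text \<open>A mesh of infinity by convention, in degree at most 1, is harmless: there the order of a zero
  is bounded by the degree.\<close>

lemma order_le_1_of_mesh:
  assumes "mesh p \<ge> 1" "p \<noteq> 0"
  shows "order x p \<le> 1"
proof (cases "degree p \<le> 1")
  case True
  then show ?thesis using order_degree[OF assms(2), of x] by simp
next
  case False
  show ?thesis
  proof (rule ccontr)
    assume "\<not> order x p \<le> 1"
    then have "\<exists>x. order x p \<ge> 2" by (intro exI[of _ x]) simp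
    with False have "mesh p = 0" by (simp add: mesh_def)
    with assms(1) show False by simp
  qed
qed

lemma root_distance_of_mesh:
  assumes "mesh p \<ge> 1" "degree p \<ge> 2" "poly p x = 0" "poly p y = 0" "x \<noteq> y"
  shows "\<bar>x - y\<bar> \<ge> 1"
proof -
  have "p \<noteq> 0" using assms(2) by auto
  have "\<nexists>x. order x p \<ge> 2"
    using order_le_1_of_mesh[OF assms(1) \<open>p \<noteq> 0\<close>] by (metis Suc_1 not_less_eq_eq)
  then have "mesh p = Inf {ereal \<bar>x - y\<bar> | x y. poly p x = 0 \<and> poly p y = 0 \<and> x \<noteq> y}"
    using assms(2) by (simp add: mesh_def)
  also have "\<dots> \<le> ereal \<bar>x - y\<bar>" using assms by (intro Inf_lower) auto
  finally show ?thesis using assms(1) by (metis ereal_less_eq(3) one_ereal_def order_trans)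
qed

text \<open>The sorted list of the zeros is the spaced sequence, and the largest zero is a bound.\<close>

lemma HP_plus_ge_1_imp_spaced:
  assumes "p \<in> HP_plus_ge_1"
  shows "\<exists>n B. p \<in> spaced_polys n B"
proof (cases "p = 0")
  case True
  have "p = smult 0 (root_poly 0 (\<lambda>_. 0))" "spaced 0 0 (\<lambda>_. 0)"
    using True by (auto simp: spaced_def)
  then show ?thesis unfolding spaced_polys_def by blast
next
  case False
  with assms have hyp: "hyperbolic p" and mesh: "mesh p \<ge> 1"
    and nonneg: "\<And>x. poly p x = 0 \<Longrightarrow> x \<ge> 0"
    by (auto simp: HP_plus_ge_1_def)
  from hyperbolic_factorization[OF hyp False order_le_1_of_mesh[OF mesh False]]
  obtain c A where c: "c \<noteq> 0" and A: "finite A" and p: "p = smult c (\<Prod>x\<in>A. [:- x, 1:])"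
    by blast
  define xs where "xs = sorted_list_of_set A"
  define n where "n = length xs"
  define x where "x j = xs ! j" for j
  have xs: "set xs = A" "distinct xs" "sorted xs"
    using A by (auto simp: xs_def)
  have bij: "bij_betw x {..<n} A"
    unfolding x_def n_def using bij_betw_nth[OF xs(2) refl xs(1)[symmetric]] by simp
  have p_eq: "p = smult c (root_poly n x)"
    unfolding p root_poly_def using prod.reindex_bij_betw[OF bij, of "\<lambda>x. [:- x, 1:]"] by simp
  have root: "poly p (x j) = 0" if "j < n" for j
    using that by (auto simp: p_eq poly_root_poly_eq_0_iff)
  have "spaced n (Max A) x"
    unfolding spaced_def
  proof (intro conjI allI impI)
    fix j assume j: "j < n"
    show "0 \<le> x j" using nonneg root[OF j] .
    show "x j \<le> Max A" using j bij A by (auto simp: bij_betw_def)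
    fix i assume i: "i < j"
    have "x i \<noteq> x j" using i j xs(2) by (simp add: x_def n_def nth_eq_iff_index_eq)
    moreover have "x i \<le> x j" using i j xs(3) by (simp add: x_def n_def sorted_nth_mono)
    moreover have "degree p \<ge> 2" using c i j by (simp add: p_eq)
    then have "\<bar>x i - x j\<bar> \<ge> 1"
      using \<open>x i \<noteq> x j\<close> root i j by (intro root_distance_of_mesh[OF mesh]) auto
    ultimately show "x i + 1 \<le> x j" by simp
  qed
  then show ?thesis unfolding spaced_polys_def using p_eq by blast
qed

lemma cpoly_root_poly: "cpoly (root_poly n x) z = (\<Prod>j<n. z - of_real (x j))"
  by (induction n) (simp_all add: root_poly_def cpoly_mult map_poly_pCons del: mult_pCons_right)

text \<open>All zeros are simple because their orders sum to at most the degree \<open>n\<close>, while there are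
  \<open>n\<close> distinct zeros.\<close>

lemma spaced_imp_HP_plus_ge_1:
  assumes "p \<in> spaced_polys n B"
  shows "p \<in> HP_plus_ge_1"
proof -
  from assms obtain c x where p: "p = smult c (root_poly n x)" and x: "spaced n B x"
    by (auto simp: spaced_polys_def)
  show ?thesis
  proof (cases "c = 0")
    case True
    then show ?thesis by (simp add: p HP_plus_ge_1_def)
  next
    case c: False
    have roots: "poly p t = 0 \<longleftrightarrow> t \<in> x ` {..<n}" for t
      using c by (auto simp: p poly_root_poly_eq_0_iff)
    have nonneg: "t \<ge> 0" if "poly p t = 0" for t
      using that x by (auto simp: roots spaced_def)
    have "p = [:c:] * root_poly n x" by (simp add: p)
    then have "cpoly p z = of_real c * (\<Prod>j<n. z - of_real (x j))" for z
      by (simp only: cpoly_mult cpoly_root_poly) (simp add: map_poly_pCons)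
    then have "hyperbolic p" using c by (auto simp: hyperbolic_def)
    moreover have "mesh p \<ge> 1"
    proof (cases "degree p \<le> 1")
      case False
      have order_le_1: "order t p \<le> 1" for t
      proof (cases "poly p t = 0")
        case True
        have "p \<noteq> 0" using c by (simp add: p)
        have fin: "finite {s. poly p s = 0}" using \<open>p \<noteq> 0\<close> by (rule poly_roots_finite)
        \<comment> \<open>The other zeros already use up at least \<open>n - 1\<close> of the available order.\<close>
        have "card ({s. poly p s = 0} - {t}) \<le> (\<Sum>s\<in>{s. poly p s = 0} - {t}. order s p)"
          using \<open>p \<noteq> 0\<close> by (subst card_eq_sum, intro sum_mono) (auto simp: Suc_le_eq order_gt_0_iff)
        also have "order t p + \<dots> = (\<Sum>s | poly p s = 0. order s p)"
          using fin True by (simp add: sum.remove)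
        also have "\<dots> \<le> degree p" using \<open>p \<noteq> 0\<close> by (rule sum_order_le_degree)
        also have "degree p = card {s. poly p s = 0}"
          unfolding Collect_mem_eq roots using c spaced_inj_on[OF x] by (simp add: p card_image)
        also have "\<dots> = Suc (card ({s. poly p s = 0} - {t}))"
          using fin True by (intro card.remove) auto
        finally show ?thesis by simp
      qed (simp add: order_0I)
      have "1 \<le> Inf {ereal \<bar>x - y\<bar> | x y. poly p x = 0 \<and> poly p y = 0 \<and> x \<noteq> y}"
      proof (rule Inf_greatest, clarify)
        fix s t assume "poly p s = 0" "poly p t = 0" "s \<noteq> t"
        then obtain i j where ij: "i < n" "j < n" "s = x i" "t = x j" "i \<noteq> j"
          by (auto simp: roots)
        then have "x i + 1 \<le> x j \<or> x j + 1 \<le> x i"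
          using x by (metis linorder_neqE_nat spaced_def)
        then have "1 \<le> \<bar>s - t\<bar>" using ij by auto
        then show "1 \<le> ereal \<bar>s - t\<bar>" by (simp add: one_ereal_def)
      qed
      moreover have "\<nexists>t. order t p \<ge> 2" using order_le_1 by (metis Suc_1 not_less_eq_eq)
      ultimately show ?thesis using False by (simp add: mesh_def)
    qed (simp add: mesh_def)
    ultimately show ?thesis using nonneg by (simp add: HP_plus_ge_1_def)
  qed
qed

section \<open>The diagonal operator\<close>

lemma pochhammer_poly_eq_root_poly: "pochhammer_poly i = root_poly i real"
  by (simp add: pochhammer_poly_def root_poly_def)

lemma falling_sum_exists:
  assumes "\<And>k. k \<ge> N \<Longrightarrow> coeff p k = 0"
  shows "\<exists>b. p = falling_sum N b"
  using assms
proof (induction N arbitrary: p)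
  case 0
  then show ?case by (auto simp: falling_sum_def poly_eq_iff)
next
  case (Suc N)
  have "coeff (p - smult (coeff p N) (pochhammer_poly N)) k = 0" if "k \<ge> N" for k
    using that Suc(2)[of k]
    by (cases "k = N") (auto simp: pochhammer_poly_eq_root_poly coeff_eq_0)
  from Suc(1)[OF this] obtain b where "p - smult (coeff p N) (pochhammer_poly N) = falling_sum N b"
    by blast
  then have "p = falling_sum (Suc N) (b(N := coeff p N))"
    by (simp add: falling_sum_def algebra_simps)
  then show ?case by blast
qed

lemma vector_space_pair_smult: "vector_space_pair smult (smult :: real \<Rightarrow> real poly \<Rightarrow> real poly)"
  unfolding vector_space_pair_def
  by (simp add: vector_space_def smult_add_right smult_add_left)

text \<open>The falling factorials are linearly independent for reasons of degree, so their images can be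
  prescribed.\<close>

lemma diagonal_operator_exists:
  "\<exists>T. Vector_Spaces.linear smult smult T \<and>
     (\<forall>i. T (pochhammer_poly i) = smult (\<alpha> i) (pochhammer_poly i))"
proof -
  interpret vector_space_pair smult "smult :: real \<Rightarrow> real poly \<Rightarrow> real poly"
    by (rule vector_space_pair_smult)
  have "inj pochhammer_poly"
    by (rule injI) (metis degree_root_poly pochhammer_poly_eq_root_poly)
  have indep: "vs1.independent (pochhammer_poly ` {..<N})" for N
  proof (induction N)
    case 0
    show ?case using vs1.independent_empty by simp
  next
    case (Suc N)
    have "vs1.span (pochhammer_poly ` {..<N}) \<subseteq> {p. \<forall>k\<ge>N. coeff p k = 0}"
      by (rule vs1.span_minimal)
        (auto simp: vs1.subspace_def pochhammer_poly_eq_root_poly intro!: coeff_eq_0)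
    then have "pochhammer_poly N \<notin> vs1.span (pochhammer_poly ` {..<N})"
      by (force simp: pochhammer_poly_eq_root_poly)
    with Suc show ?case by (simp add: lessThan_Suc vs1.independent_insertI)
  qed
  \<comment> \<open>The finite initial segments form a chain whose union is the whole family.\<close>
  have "vs1.independent (\<Union>(range (\<lambda>N. pochhammer_poly ` {..<N})))"
  proof (rule vs1.independent_Union_directed)
    fix c d assume "c \<in> range (\<lambda>N. pochhammer_poly ` {..<N})" "d \<in> range (\<lambda>N. pochhammer_poly ` {..<N})"
    then obtain M N where "c = pochhammer_poly ` {..<M}" "d = pochhammer_poly ` {..<N}" by auto
    then show "c \<subseteq> d \<or> d \<subseteq> c" by (cases "M \<le> N") (auto intro!: image_mono)
  qed (use indep in auto)
  then obtain T where T: "Vector_Spaces.linear smult smult T"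
    "\<forall>v \<in> (\<Union>(range (\<lambda>N. pochhammer_poly ` {..<N}))). T v = smult (\<alpha> (inv pochhammer_poly v)) v"
    using linear_independent_extend[of _ "\<lambda>v. smult (\<alpha> (inv pochhammer_poly v)) v"] by blast
  have "T (pochhammer_poly i) = smult (\<alpha> i) (pochhammer_poly i)" for i
  proof -
    have "pochhammer_poly i \<in> pochhammer_poly ` {..<Suc i}" by simp
    then show ?thesis using T(2) inv_f_f[OF \<open>inj pochhammer_poly\<close>, of i] by (metis UN_I UNIV_I)
  qed
  with T(1) show ?thesis by blast
qed

lemma preserves_spacing_imp_multiplier:
  assumes "preserves_spacing \<alpha>"
  shows "discrete_multiplier_sequence \<alpha>"
proof -
  obtain T where T: "Vector_Spaces.linear smult smult T"
    and diag: "\<And>i. T (pochhammer_poly i) = smult (\<alpha> i) (pochhammer_poly i)"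
    using diagonal_operator_exists[of \<alpha>] by blast
  interpret vector_space_pair smult "smult :: real \<Rightarrow> real poly \<Rightarrow> real poly"
    by (rule vector_space_pair_smult)
  have T_sum: "T (falling_sum N b) = falling_sum N (\<lambda>i. \<alpha> i * b i)" for N b
    using T diag by (simp add: falling_sum_def linear_sum linear_scale mult.commute)
  have "T p \<in> HP_plus_ge_1" if p: "p \<in> HP_plus_ge_1" for p
  proof -
    obtain n B where nB: "p \<in> spaced_polys n B" using HP_plus_ge_1_imp_spaced[OF p] by blast
    obtain b where "p = falling_sum (Suc (degree p)) b"
      using falling_sum_exists[of "Suc (degree p)" p] by (auto simp: coeff_eq_0)
    then show ?thesis
      using nB by (metis T_sum assms preserves_spacingD spaced_imp_HP_plus_ge_1)
  qed
  with T diag show ?thesis unfolding discrete_multiplier_sequence_def by blast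
qed

theorem theorem6:
  fixes \<phi> :: "complex \<Rightarrow> complex" and P :: "nat \<Rightarrow> real poly"
  assumes entire: "\<phi> holomorphic_on UNIV"
    and real: "\<And>z. z \<in> \<real> \<Longrightarrow> \<phi> z \<in> \<real>"
    and negative_zeros: "\<And>n z. cpoly (P n) z = 0 \<Longrightarrow> z \<in> \<real> \<and> Re z < 0"
    and limit: "\<And>K. compact K \<Longrightarrow> uniform_limit K (\<lambda>n. cpoly (P n)) \<phi> sequentially"
  shows "discrete_multiplier_sequence (\<lambda>i. Re (\<phi> (of_nat i)))"
proof (rule preserves_spacing_imp_multiplier, rule preserves_spacing_limit)
  show "preserves_spacing (\<lambda>i. poly (P m) (real i))" for m
    using negative_zeros by (rule preserves_spacing_negative_zeros)
  show "(\<lambda>m. poly (P m) (real i)) \<longlonglongrightarrow> Re (\<phi> (of_nat i))" for i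
  proof -
    have "(\<lambda>m. cpoly (P m) (of_nat i)) \<longlonglongrightarrow> \<phi> (of_nat i)"
      using limit[of "{of_nat i}"] by (auto intro: tendsto_uniform_limitI)
    then have "(\<lambda>m. Re (cpoly (P m) (of_real (real i)))) \<longlonglongrightarrow> Re (\<phi> (of_nat i))"
      by (intro tendsto_Re) simp
    then show ?thesis by (simp only: cpoly_of_real Re_complex_of_real)
  qed
qed

end
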